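(* For every integer $k\geq 2$, \[ f_m(2k)=3-\frac{2}{k}\qquad\text{and}\qquad f_m(2k+3)=3-\frac{1}{k}. \]
   Context: Let $n\neq 1,2,3,5$ be a positive integer. A tiling $T$ of the unit square with $n$ tiles is a collection of $n$ squares (called tiles), each of positive side length, placed inside the unit square so that they completely fill it and have pairwise non-overlapping (disjoint) interiors; tiles may have equal side lengths. If $s_1,\ldots,s_n$ are the side lengths of the tiles of $T$ (so $s_i>0$ for all $i$), the total length of $T$ is $\sigma(T)=s_1+\cdots+s_n$. Define $f_m(n)=\min_T\sigma(T)$, where the minimum is taken over all tilings $T$ of the unit square with exactly $n$ tiles. *)

theory Defs
  imports "HOL-Analysis.Analysis"
begin

text \<open>A closed square with side length s in the plane, in arbitrary position: the vectors u and v
  are the directions of its sides, so rotated squares are included.\<close>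

definition is_square :: "(real \<times> real) set \<Rightarrow> real \<Rightarrow> bool" where
  "is_square S s \<longleftrightarrow> s > 0 \<and>
     (\<exists>p u v. norm u = 1 \<and> norm v = 1 \<and> u \<bullet> v = 0 \<and>
        S = {p + x *\<^sub>R u + y *\<^sub>R v | x y. 0 \<le> x \<and> x \<le> s \<and> 0 \<le> y \<and> y \<le> s})"

definition unit_square :: "(real \<times> real) set" where
  "unit_square = {0..1} \<times> {0..1}"

text \<open>The tiles are \<open>S 0, \<dots>, S (n - 1)\<close>, and \<open>s i\<close> is the side length of \<open>S i\<close>;
  values at indices \<open>i \<ge> n\<close> are irrelevant.\<close>

definition square_tiling :: "nat \<Rightarrow> (nat \<Rightarrow> (real \<times> real) set) \<Rightarrow> (nat \<Rightarrow> real) \<Rightarrow> bool" where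
  "square_tiling n S s \<longleftrightarrow>
     (\<forall>i<n. is_square (S i) (s i)) \<and>
     (\<Union>i<n. S i) = unit_square \<and>
     (\<forall>i<n. \<forall>j<n. i \<noteq> j \<longrightarrow> interior (S i) \<inter> interior (S j) = {})"

definition total_lengths :: "nat \<Rightarrow> real set" where
  "total_lengths n = {(\<Sum>i<n. s i) | S s. square_tiling n S s}"

text \<open>The set \<open>total_lengths n\<close> is bounded below by 0, so this infimum is a minimum exactly when
  it is an element of \<open>total_lengths n\<close>; attainment has to be asserted separately.\<close>

definition f_m :: "nat \<Rightarrow> real" where
  "f_m n = Inf (total_lengths n)"

end

theory Submission
  imports Defs
begin

text \<open>Write \<open>D = 3 L - \<sigma>\<close> for the deficit of a tiling of a square of side \<open>L\<close> with total length
  \<open>\<sigma>\<close>. Since \<open>\<sigma>\<close> is the integral of the number of tiles met by a row, a positive deficit forces a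
  row, and likewise a column, that meets exactly two tiles. These pairs share a tile \<open>A\<close>, which lies
  in a corner and has side \<open>L - w \<ge> L / 2\<close>; its partners have side \<open>w\<close>. Comparing areas gives
  \<open>D \<le> 2 w\<close>. On the other hand, deleting the two partners, shrinking \<open>A\<close> by \<open>w\<close> and closing the
  gaps yields a tiling of a square of side \<open>L - w\<close> by \<open>n - 2\<close> tiles (\<open>n - 3\<close> if \<open>A\<close> disappears)
  with the same deficit. Induction on \<open>n\<close> gives \<open>n D \<le> 4 L\<close> for all \<open>n\<close> and \<open>(n - 3) D \<le> 2 L\<close> for
  odd \<open>n > 1\<close>. The extremal tilings are a square of side \<open>1 - 1 / k\<close> in a corner with \<open>2 k - 1\<close>
  tiles of side \<open>1 / k\<close>, and the same tiling with one small tile cut into four.\<close>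

section \<open>Perfect packings\<close>

text \<open>Covering is expressed by the area equation, which is symmetric under reflections and can be
  rechecked by algebra after tiles have been moved.\<close>

definition perfect_packing ::
    "'a set \<Rightarrow> ('a \<Rightarrow> real) \<Rightarrow> ('a \<Rightarrow> real) \<Rightarrow> ('a \<Rightarrow> real) \<Rightarrow> real \<Rightarrow> bool" where
  "perfect_packing I x y s L \<longleftrightarrow> finite I \<and> L > 0 \<and>
     (\<forall>i\<in>I. 0 < s i \<and> 0 \<le> x i \<and> x i + s i \<le> L \<and> 0 \<le> y i \<and> y i + s i \<le> L) \<and>
     (\<forall>i\<in>I. \<forall>j\<in>I. i \<noteq> j \<longrightarrow>
        x i + s i \<le> x j \<or> x j + s j \<le> x i \<or> y i + s i \<le> y j \<or> y j + s j \<le> y i) \<and>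
     (\<Sum>i\<in>I. (s i)\<^sup>2) = L\<^sup>2"

lemma perfect_packingD:
  assumes "perfect_packing I x y s L"
  shows "finite I" "L > 0"
    "\<And>i. i \<in> I \<Longrightarrow> 0 < s i" "\<And>i. i \<in> I \<Longrightarrow> 0 \<le> x i" "\<And>i. i \<in> I \<Longrightarrow> x i + s i \<le> L"
    "\<And>i. i \<in> I \<Longrightarrow> 0 \<le> y i" "\<And>i. i \<in> I \<Longrightarrow> y i + s i \<le> L"
    "\<And>i j. i \<in> I \<Longrightarrow> j \<in> I \<Longrightarrow> i \<noteq> j \<Longrightarrow>
       x i + s i \<le> x j \<or> x j + s j \<le> x i \<or> y i + s i \<le> y j \<or> y j + s j \<le> y i"
    "(\<Sum>i\<in>I. (s i)\<^sup>2) = L\<^sup>2"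
  using assms unfolding perfect_packing_def by blast+

lemma perfect_packing_transpose:
  "perfect_packing I x y s L \<Longrightarrow> perfect_packing I y x s L"
  unfolding perfect_packing_def by (elim conjE, intro conjI) blast+

lemma perfect_packing_reflect:
  assumes "perfect_packing I x y s L"
  shows "perfect_packing I (\<lambda>i. L - x i - s i) y s L"
proof -
  note P = perfect_packingD[OF assms]
  have "L - x i - s i + s i \<le> L - x j - s j \<or> L - x j - s j + s j \<le> L - x i - s i \<or>
      y i + s i \<le> y j \<or> y j + s j \<le> y i" if "i \<in> I" "j \<in> I" "i \<noteq> j" for i j
    using P(8)[OF that] by linarith
  moreover have "0 \<le> L - x i - s i \<and> L - x i - s i + s i \<le> L" if "i \<in> I" for i
    using P(4,5)[OF that] by linarith
  ultimately show ?thesis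
    using P unfolding perfect_packing_def by blast
qed

text \<open>Whichever separation holds, the two tiles follow each other along one axis inside an
  interval of length \<open>L\<close>.\<close>

lemma perfect_packing_pair:
  assumes "perfect_packing I x y s L" "i \<in> I" "j \<in> I" "i \<noteq> j"
  shows "s i + s j \<le> L"
  using perfect_packingD(4-7)[OF assms(1,2)] perfect_packingD(4-7)[OF assms(1,3)]
    perfect_packingD(8)[OF assms] by linarith

section \<open>Rows of a packing\<close>

lemma has_integral_indicator_interval:
  fixes a b c d :: real
  assumes "a \<le> c" "c \<le> d" "d \<le> b"
  shows "(indicat_real {c..<d} has_integral d - c) {a..b}"
proof -
  have "((\<lambda>_. 1::real) has_integral d - c) {c..d}"
    using has_integral_const_real[of "1::real" c d] assms by simp
  then have "((\<lambda>t. if t \<in> {c..d} then 1 else 0::real) has_integral d - c) {a..b}"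
    using assms has_integral_restrict[of "{c..d}" "{a..b}" "\<lambda>_. 1::real"] by auto
  then show ?thesis
    by (rule has_integral_spike_finite[where S="{d}", rotated 2]) (auto simp: indicator_def)
qed

text \<open>The indicators of the disjoint intervals add up to at most 1; integrate over
  \<open>{0..L}\<close>. Half-open intervals keep touching ones disjoint.\<close>

lemma sum_disjoint_intervals_le:
  fixes x s :: "'a \<Rightarrow> real"
  assumes "finite J" "0 \<le> L"
    and "\<And>i. i \<in> J \<Longrightarrow> 0 < s i \<and> 0 \<le> x i \<and> x i + s i \<le> L"
    and "\<And>i j. i \<in> J \<Longrightarrow> j \<in> J \<Longrightarrow> i \<noteq> j \<Longrightarrow> x i + s i \<le> x j \<or> x j + s j \<le> x i"
  shows "sum s J \<le> L"
proof -
  have 1: "((\<lambda>t. \<Sum>i\<in>J. indicat_real {x i..<x i + s i} t) has_integral (\<Sum>i\<in>J. x i + s i - x i)) {0..L}"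
    using assms(1,3) by (intro has_integral_sum has_integral_indicator_interval) (auto intro: less_imp_le)
  have 2: "((\<lambda>t. 1::real) has_integral L) {0..L}"
    using has_integral_const_real[of "1::real" 0 L] assms(2) by simp
  have "(\<Sum>i\<in>J. indicat_real {x i..<x i + s i} t) \<le> 1" for t
  proof (cases "\<exists>i\<in>J. t \<in> {x i..<x i + s i}")
    case True
    then obtain i where i: "i \<in> J" "t \<in> {x i..<x i + s i}" by blast
    have "(\<Sum>j\<in>J. indicat_real {x j..<x j + s j} t) = (\<Sum>j\<in>J. if j = i then 1 else 0)"
    proof (rule sum.cong)
      fix j assume "j \<in> J"
      then show "indicat_real {x j..<x j + s j} t = (if j = i then 1 else 0)"
        using i assms(4)[of i j] by (auto simp: indicator_def)
    qed simp
    then show ?thesis using i assms(1) by simp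
  next
    case False
    then show ?thesis by (simp add: indicator_def sum.neutral)
  qed
  then have "(\<Sum>i\<in>J. x i + s i - x i) \<le> L"
    using has_integral_le[OF 1 2] by blast
  then show ?thesis by simp
qed

text \<open>Tiles whose half-open vertical ranges share \<open>t\<close> cannot be separated
  vertically, so their horizontal ranges are disjoint.\<close>

lemma perfect_packing_row_le:
  assumes "perfect_packing I x y s L"
  shows "(\<Sum>i | i \<in> I \<and> t \<in> {y i..<y i + s i}. s i) \<le> L"
proof (rule sum_disjoint_intervals_le)
  note P = perfect_packingD[OF assms]
  show "finite {i \<in> I. t \<in> {y i..<y i + s i}}" "0 \<le> L" using P(1,2) by auto
  show "0 < s i \<and> 0 \<le> x i \<and> x i + s i \<le> L" if "i \<in> {i \<in> I. t \<in> {y i..<y i + s i}}" for i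
    using that P by auto
  show "x i + s i \<le> x j \<or> x j + s j \<le> x i"
    if "i \<in> {i \<in> I. t \<in> {y i..<y i + s i}}" "j \<in> {i \<in> I. t \<in> {y i..<y i + s i}}" "i \<noteq> j" for i j
    using P(8)[of i j] that by auto
qed

text \<open>Integrating the number of tiles in a row over all rows yields the total length, so a row
  with fewer than three tiles exists; the multiple \<open>K\<close> of the uncovered length, which
  integrates to 0, makes sure that this row is full.\<close>

lemma perfect_packing_short_row:
  assumes P: "perfect_packing I x y s L" and short: "sum s I < 3 * L"
  obtains t where "(\<Sum>i | i \<in> I \<and> t \<in> {y i..<y i + s i}. s i) = L"
    "card {i \<in> I. t \<in> {y i..<y i + s i}} < 3"
proof -
  note P' = perfect_packingD[OF P]
  define R where "R t = {i \<in> I. t \<in> {y i..<y i + s i}}" for t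
  \<comment> \<open>Only finitely many subsets of \<open>I\<close> exist, so the positive uncovered
    lengths have a positive minimum; the element 1 keeps the set nonempty.\<close>
  define G where "G = insert 1 ((\<lambda>J. L - sum s J) ` {J. J \<subseteq> I \<and> sum s J < L})"
  have finG: "finite G" unfolding G_def using P'(1) by auto
  have Gpos: "Min G > 0" using finG by (subst Min_gr_iff) (auto simp: G_def)
  \<comment> \<open>With this factor any uncovered length contributes at least 3 to
    \<open>ph\<close>, which outweighs its \<open>- 3\<close>.\<close>
  define K where "K = 3 / Min G"
  have K: "K > 0" unfolding K_def using Gpos by simp
  define ph where "ph t = K * (L - sum s (R t)) + (real (card (R t)) - 3)" for t
  have fin: "finite (R t)" for t unfolding R_def using P'(1) by simp
  have ind: "sum f (R t) = (\<Sum>i\<in>I. f i * indicat_real {y i..<y i + s i} t)" for f :: "_ \<Rightarrow> real" and t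
  proof -
    have "sum f (R t) = (\<Sum>i\<in>I. if t \<in> {y i..<y i + s i} then f i else 0)"
      unfolding R_def using P'(1) by (rule sum.inter_filter)
    also have "\<dots> = (\<Sum>i\<in>I. f i * indicat_real {y i..<y i + s i} t)"
      by (intro sum.cong) (auto simp: indicator_def)
    finally show ?thesis .
  qed
  have const: "((\<lambda>t. c) has_integral L * c) {0..L}" for c :: real
    using has_integral_const_real[of c 0 L] P'(2) by simp
  have "ph = (\<lambda>t. K * (L - (\<Sum>i\<in>I. s i * indicat_real {y i..<y i + s i} t)) +
      ((\<Sum>i\<in>I. 1 * indicat_real {y i..<y i + s i} t) - 3))"
    unfolding ph_def ind[symmetric] by simp
  moreover have "((\<lambda>t. K * (L - (\<Sum>i\<in>I. s i * indicat_real {y i..<y i + s i} t)) +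
      ((\<Sum>i\<in>I. 1 * indicat_real {y i..<y i + s i} t) - 3)) has_integral
      K * (L * L - (\<Sum>i\<in>I. s i * (y i + s i - y i))) + ((\<Sum>i\<in>I. 1 * (y i + s i - y i)) - L * 3)) {0..L}"
    using P'(1,3-7)
    by (intro has_integral_add has_integral_mult_right has_integral_diff has_integral_sum
        has_integral_indicator_interval const) (auto intro: less_imp_le)
  \<comment> \<open>The area equation makes the \<open>K\<close> term integrate to 0, which leaves
    \<open>sum s I - 3 * L < 0\<close>.\<close>
  moreover have "(\<Sum>i\<in>I. s i * (y i + s i - y i)) = L * L"
    using P'(9) by (simp add: power2_eq_square)
  ultimately have int: "(ph has_integral sum s I - L * 3) {0..L}" by simp
  have "\<exists>t\<in>{0..L}. ph t < 0"
  proof (rule ccontr)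
    assume "\<not> ?thesis"
    then have "0 \<le> sum s I - L * 3" by (intro has_integral_nonneg[OF int]) (auto simp: not_less)
    then show False using short by simp
  qed
  then obtain t where t: "ph t < 0" by blast
  have le: "sum s (R t) \<le> L" unfolding R_def by (rule perfect_packing_row_le[OF P])
  have c: "card (R t) < 3"
  proof (rule ccontr)
    assume "\<not> ?thesis"
    then have "0 \<le> K * (L - sum s (R t)) + (real (card (R t)) - 3)"
      using le K by (intro add_nonneg_nonneg mult_nonneg_nonneg) auto
    then show False using t unfolding ph_def by simp
  qed
  have "sum s (R t) = L"
  proof (rule ccontr)
    assume "sum s (R t) \<noteq> L"
    then have "L - sum s (R t) \<in> G" unfolding G_def R_def[of t] using le by (auto simp: R_def)
    then have "Min G \<le> L - sum s (R t)" using finG by simp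
    then have "K * Min G \<le> K * (L - sum s (R t))" using K by simp
    moreover have "K * Min G = 3" unfolding K_def using Gpos by simp
    ultimately show False using t unfolding ph_def by simp
  qed
  then show ?thesis using that[of t] c unfolding R_def by blast
qed

text \<open>The short full row has a tile because \<open>L > 0\<close>. A single one would have side
  \<open>L\<close> and leave no room for a second tile of the packing. So there are two, and
  \<open>i\<close> names the left one.\<close>

lemma perfect_packing_two_tile_row:
  assumes P: "perfect_packing I x y s L" and short: "sum s I < 3 * L" and card: "card I \<ge> 2"
  obtains i j where "i \<in> I" "j \<in> I" "i \<noteq> j" "s i + s j = L" "x i = 0" "x j = s i"
    "y i < y j + s j" "y j < y i + s i"
proof -
  note P' = perfect_packingD[OF P]
  obtain t where t: "(\<Sum>i | i \<in> I \<and> t \<in> {y i..<y i + s i}. s i) = L"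
    "card {i \<in> I. t \<in> {y i..<y i + s i}} < 3"
    by (rule perfect_packing_short_row[OF P short])
  define J where "J = {i \<in> I. t \<in> {y i..<y i + s i}}"
  have J: "sum s J = L" "card J < 3" "finite J" "J \<subseteq> I" using t P'(1) unfolding J_def by auto
  have "card J \<noteq> 0" using J P'(2) by auto
  moreover have "card J \<noteq> 1"
  proof
    assume "card J = 1"
    then obtain i where i: "J = {i}" by (auto simp: card_1_singleton_iff)
    with J have i': "i \<in> I" "s i = L" by auto
    have "\<not> card I \<le> Suc 0" using card by simp
    then obtain j where "j \<in> I" "j \<noteq> i"
      using card_le_Suc0_iff_eq[OF P'(1)] by blast
    then show False using perfect_packing_pair[OF P i'(1), of j] P'(3)[of j] i' by auto
  qed
  ultimately have "card J = 2" using J(2) by linarith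
  then obtain i j where ij: "J = {i, j}" "i \<noteq> j" by (auto simp: card_2_iff)
  have m: "i \<in> I" "j \<in> I" "s i + s j = L" using J ij by auto
  have "i \<in> J" "j \<in> J" using ij by auto
  then have ov: "y i < y j + s j" "y j < y i + s i" unfolding J_def by auto
  have "x i = 0 \<and> x j = s i \<or> x j = 0 \<and> x i = s j"
    using P'(8)[OF m(1,2) ij(2)] P'(4,5)[OF m(1)] P'(4,5)[OF m(2)] m(3) ov by linarith
  then show ?thesis using that[of i j] that[of j i] m ij(2) ov by (auto simp: add.commute)
qed

text \<open>All other tiles have side at most \<open>L - s A\<close>, so the area
  \<open>L\<^sup>2 - (s A)\<^sup>2\<close> they cover is at most \<open>L - s A\<close> times their
  total length; cancel this factor.\<close>

lemma perfect_packing_deficit_le: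
  assumes P: "perfect_packing I x y s L" and A: "A \<in> I" and lt: "s A < L"
  shows "3 * L - sum s I \<le> 2 * (L - s A)"
proof -
  note P' = perfect_packingD[OF P]
  have "L\<^sup>2 - (s A)\<^sup>2 = (\<Sum>i\<in>I-{A}. (s i)\<^sup>2)"
    using P'(9) A P'(1) by (simp add: sum_diff1)
  also have "\<dots> \<le> (\<Sum>i\<in>I-{A}. (L - s A) * s i)"
    using perfect_packing_pair[OF P A] P'(3)
    by (intro sum_mono) (force simp: power2_eq_square intro!: mult_right_mono)
  also have "\<dots> = (L - s A) * (sum s I - s A)"
    using A P'(1) by (simp add: sum_diff1 flip: sum_distrib_left)
  finally have "(L - s A) * (L + s A) \<le> (L - s A) * (sum s I - s A)"
    by (simp add: power2_eq_square algebra_simps)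
  then have "L + s A \<le> sum s I - s A" using lt by simp
  then show ?thesis by simp
qed

text \<open>A two-tile row and a two-tile column give two pairs with side sum \<open>L\<close>.
  \<open>A\<close> is a common tile, \<open>B\<close> its partner in the row and \<open>C\<close>
  its partner in the column.\<close>

lemma perfect_packing_corner:
  assumes P: "perfect_packing I x y s L" and short: "sum s I < 3 * L" and card: "card I \<ge> 2"
  obtains A B C where "A \<in> I" "B \<in> I" "C \<in> I" "A \<noteq> B" "A \<noteq> C"
    "s B = L - s A" "s C = L - s A" "s A \<ge> L - s A" "s A < L"
    "x A = 0 \<and> x B = s A \<or> x B = 0 \<and> x A = s B"
    "y A = 0 \<and> y C = s A \<or> y C = 0 \<and> y A = s C"
    "y A < y B + s B" "y B < y A + s A" "x A < x C + s C" "x C < x A + s A"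
proof -
  note P' = perfect_packingD[OF P]
  obtain i j where h: "i \<in> I" "j \<in> I" "i \<noteq> j" "s i + s j = L" "x i = 0" "x j = s i"
    "y i < y j + s j" "y j < y i + s i"
    by (rule perfect_packing_two_tile_row[OF P short card])
  obtain i' j' where v: "i' \<in> I" "j' \<in> I" "i' \<noteq> j'" "s i' + s j' = L" "y i' = 0" "y j' = s i'"
    "x i' < x j' + s j'" "x j' < x i' + s i'"
    by (rule perfect_packing_two_tile_row[OF perfect_packing_transpose[OF P] short card])
  have h': "0 < s i" "0 < s j" "0 < s i'" "0 < s j'" using h v P'(3) by auto
  \<comment> \<open>A tile of one pair with side above \<open>L / 2\<close> belongs to the other
    pair: otherwise adding its side bounds against both tiles there would give at most
    \<open>L / 2\<close>. Only four equal sides need geometry.\<close>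
  have "\<exists>A\<in>{i,j} \<inter> {i',j'}. s A \<ge> L - s A"
  proof (cases "s i = s j \<and> s i' = s j'")
    case True
    then have half: "s i = L/2" "s j = L/2" "s i' = L/2" "s j' = L/2" using h v by auto
    have "i = i' \<or> i = j' \<or> j = i' \<or> j = j'"
    proof (rule ccontr)
      assume "\<not> ?thesis"
      then have ne: "i \<noteq> i'" "i \<noteq> j'" "j \<noteq> i'" "j \<noteq> j'" by auto
      \<comment> \<open>With all sides \<open>L / 2\<close>, keeping the row tiles off the column
        tiles pushes one pair apart by \<open>L / 2\<close> in the direction in which it overlaps
        strictly.\<close>
      show False
        using P'(8)[OF h(1) v(1) ne(1)] P'(8)[OF h(1) v(2) ne(2)]
          P'(8)[OF h(2) v(1) ne(3)] P'(8)[OF h(2) v(2) ne(4)]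
          P'(4-7)[OF h(1)] P'(4-7)[OF h(2)] P'(4-7)[OF v(1)] P'(4-7)[OF v(2)] P'(2)
          h(5-8) v(5-8) unfolding half by argo
    qed
    then obtain A where "A \<in> {i,j}" "A \<in> {i',j'}" by blast
    moreover from this have "s A \<ge> L - s A" using half by auto
    ultimately show ?thesis by blast
  next
    case False
    then show ?thesis
      using perfect_packing_pair[OF P h(1) v(1)] perfect_packing_pair[OF P h(1) v(2)]
        perfect_packing_pair[OF P h(2) v(1)] perfect_packing_pair[OF P h(2) v(2)] h(3,4) v(3,4)
      by (cases "s i \<le> s j"; cases "s i' \<le> s j'"; cases "i = i'"; cases "i = j'"; cases "j = i'"; cases "j = j'";
          simp; linarith)
  qed
  then obtain A where A: "A = i \<or> A = j" "A = i' \<or> A = j'" "s A \<ge> L - s A" by auto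
  show ?thesis
    using A(1,2)
    by (elim disjE) (rule that[of A "if A = i then j else i" "if A = i' then j' else i'"];
        use h v h' A(3) in auto)+
qed

section \<open>Contraction of a corner tile\<close>

text \<open>The tile \<open>A\<close> keeps its lower left vertex \<open>(w, w)\<close> and all other tiles lie in the left or the
  bottom strip of width \<open>w\<close>. In the left strip the tiles above \<open>B\<close> move down by \<open>w\<close>, in the bottom
  strip the tiles right of \<open>C\<close> move left by \<open>w\<close>. If \<open>B\<close> or \<open>C\<close> reaches into the common corner of the
  strips, the other one does not, so the moved tiles do not collide.\<close>

lemma perfect_packing_contract_upper_right:
  fixes x y s :: "'a \<Rightarrow> real"
  assumes P: "perfect_packing I x y s L"
    and ABC: "A \<in> I" "B \<in> I" "C \<in> I" "A \<noteq> B" "A \<noteq> C"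
    and w: "s B = w" "s C = w" "s A = L - w" "w \<le> s A"
    and pos: "x A = w" "y A = w" "x B = 0" "y C = 0" "w < y B + w" "w < x C + w"
  defines "I' \<equiv> I - (if s A = w then {A, B, C} else {B, C})"
  shows "\<exists>x' y'. perfect_packing I' x' y' (s(A := s A - w)) (L - w)" "B \<noteq> C"
proof -
  note P' = perfect_packingD[OF P]
  have wpos: "w > 0" using P'(3)[OF ABC(2)] w by simp
  have BC: "B \<noteq> C"
  proof
    assume "B = C"
    then show False
      using P'(8)[OF ABC(1,2,4)] pos w wpos P'(4)[OF ABC(2)] by auto
  qed
  then show "B \<noteq> C" .
  have strip: "x i + s i \<le> w \<or> y i + s i \<le> w" if "i \<in> I" "i \<noteq> A" for i
    using P'(8)[OF that(1) ABC(1) that(2)] P'(3,5,7)[OF that(1)] pos w by auto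
  \<comment> \<open>\<open>B\<close> spans the full width of the left strip, so a tile that starts
    inside this strip lies below or above \<open>B\<close>. \<open>C\<close> plays the same role in
    the bottom strip.\<close>
  have sepB: "w \<le> x i \<or> y i + s i \<le> y B \<or> y B + w \<le> y i" if "i \<in> I" "i \<noteq> B" for i
    using P'(8)[OF that(1) ABC(2) that(2)] P'(3,4)[OF that(1)] pos w by auto
  have sepC: "w \<le> y i \<or> x i + s i \<le> x C \<or> x C + w \<le> x i" if "i \<in> I" "i \<noteq> C" for i
    using P'(8)[OF that(1) ABC(3) that(2)] P'(3,6)[OF that(1)] pos w by auto
  have sepBC: "w \<le> x C \<or> w \<le> y B"
    using sepB[OF ABC(3)] BC pos w wpos by auto
  have yB: "0 < y B" "y B + w \<le> L" and xC: "0 < x C" "x C + w \<le> L"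
    using pos w P'(7)[OF ABC(2)] P'(5)[OF ABC(3)] by auto
  \<comment> \<open>No tile moves in both directions: tiles right of \<open>C\<close> start beyond
    \<open>w\<close>, since \<open>x C > 0\<close>, and are not in the left strip; symmetrically for
    tiles above \<open>B\<close>.\<close>
  define x' where "x' i = (if i \<noteq> A \<and> y i + s i \<le> w \<and> x C + w \<le> x i then x i - w else x i)" for i
  define y' where "y' i = (if i \<noteq> A \<and> x i + s i \<le> w \<and> y B + w \<le> y i then y i - w else y i)" for i
  define s' where "s' = s(A := s A - w)"
  have I': "i \<in> I" "i \<noteq> B" "i \<noteq> C" "i = A \<Longrightarrow> w < s A" if "i \<in> I'" for i
    using that w unfolding I'_def by (auto split: if_splits)
  have "L - w > 0" using w wpos by linarith
  moreover have "finite I'" unfolding I'_def using P'(1) by simp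
  moreover have "0 < s' i \<and> 0 \<le> x' i \<and> x' i + s' i \<le> L - w \<and> 0 \<le> y' i \<and> y' i + s' i \<le> L - w"
    if i: "i \<in> I'" for i
  proof (cases "i = A")
    case True
    then show ?thesis using I'[OF i] pos w wpos unfolding x'_def y'_def s'_def by simp
  next
    case False
    note i' = I'[OF i]
    show ?thesis
      using False strip[OF i'(1) False] sepB[OF i'(1,2)] sepC[OF i'(1,3)] P'(3-7)[OF i'(1)]
        yB xC w(3,4) unfolding x'_def y'_def s'_def by auto
  qed
  moreover have "x' i + s' i \<le> x' j \<or> x' j + s' j \<le> x' i \<or> y' i + s' i \<le> y' j \<or> y' j + s' j \<le> y' i"
    if ij: "i \<in> I'" "j \<in> I'" "i \<noteq> j" for i j
  proof -
    note i' = I'[OF ij(1)] and j' = I'[OF ij(2)]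
    have sA: "x' k + s' k \<le> w \<or> y' k + s' k \<le> w" if "k \<in> I" "k \<noteq> A" for k
      using strip[OF that] that(2) wpos unfolding x'_def y'_def s'_def by auto
    have A': "x' A = w" "y' A = w" using pos unfolding x'_def y'_def by auto
    show ?thesis
    proof (cases "i = A \<or> j = A")
      case True
      then show ?thesis using sA[OF i'(1)] sA[OF j'(1)] A' ij(3) by auto
    next
      case False
      then have ne: "i \<noteq> A" "j \<noteq> A" by auto
      \<comment> \<open>Within a strip, the removed tile leaves exactly the gap \<open>w\<close>
        that is closed. Across strips, if \<open>w \<le> x C\<close>, then tiles moved left stay
        right of the left strip. Otherwise \<open>w \<le> y B\<close>, so tiles moved down stay
        above the bottom strip, and an unmoved tile of the left strip is above it or left of
        \<open>x C\<close>.\<close>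
      show ?thesis
        using P'(8)[OF i'(1) j'(1) ij(3)] strip[OF i'(1) ne(1)] strip[OF j'(1) ne(2)]
          sepB[OF i'(1,2)] sepC[OF i'(1,3)] sepB[OF j'(1,2)] sepC[OF j'(1,3)]
          P'(3,4,6)[OF i'(1)] P'(3,4,6)[OF j'(1)] sepBC ne yB(1) xC(1) wpos
        unfolding x'_def y'_def s'_def
        by (smt (verit) fun_upd_other)
    qed
  qed
  moreover have "(\<Sum>i\<in>I'. (s' i)\<^sup>2) = (L - w)\<^sup>2"
  proof -
    \<comment> \<open>If \<open>A\<close> is dropped, then \<open>s' A = 0\<close>, so both cases of
      \<open>I'\<close> have the same sum.\<close>
    have "(\<Sum>i\<in>I'. (s' i)\<^sup>2) = (\<Sum>i\<in>I-{B,C}. (s' i)\<^sup>2)"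
      using P'(1) by (intro sum.mono_neutral_left) (auto simp: I'_def s'_def)
    also have "\<dots> = (\<Sum>i\<in>I-{B,C}-{A}. (s' i)\<^sup>2) + (s A - w)\<^sup>2"
      using ABC P'(1) by (subst sum.remove[of _ A]) (auto simp: s'_def)
    also have "(\<Sum>i\<in>I-{B,C}-{A}. (s' i)\<^sup>2) = (\<Sum>i\<in>I-{B,C}-{A}. (s i)\<^sup>2)"
      by (intro sum.cong) (auto simp: s'_def)
    also have "I-{B,C}-{A} = I - {A,B,C}" by auto
    also have "(\<Sum>i\<in>I-{A,B,C}. (s i)\<^sup>2) = L\<^sup>2 - ((L - w)\<^sup>2 + w\<^sup>2 + w\<^sup>2)"
      using P'(1,9) ABC BC w by (subst sum_diff) auto
    finally show ?thesis using w(3) by (simp add: power2_eq_square algebra_simps)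
  qed
  ultimately show "\<exists>x' y'. perfect_packing I' x' y' (s(A := s A - w)) (L - w)"
    unfolding perfect_packing_def s'_def by blast
qed

text \<open>Reflections reduce this to the previous case. Two sides \<open>w\<close> go and
  \<open>A\<close> loses \<open>w\<close>, so the sum drops by \<open>3 * w\<close>, which matches
  the smaller square and preserves the deficit. \<open>A\<close> vanishes exactly when
  \<open>2 * w = L\<close>.\<close>

lemma perfect_packing_contract:
  assumes P: "perfect_packing I x y s L" and short: "sum s I < 3 * L" and card: "card I \<ge> 2"
  obtains I' x' y' s' A w where "perfect_packing I' x' y' s' (L - w)" "0 < w" "w < L"
    "A \<in> I" "s A = L - w" "\<forall>i\<in>I. s i \<le> s A"
    "3 * (L - w) - sum s' I' = 3 * L - sum s I"
    "card I = card I' + 2 \<and> A \<in> I' \<and> s' A = s A - w \<and> 2 * w < L \<or> card I = card I' + 3 \<and> 2 * w = L"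
proof -
  note P' = perfect_packingD[OF P]
  obtain A B C where ABC: "A \<in> I" "B \<in> I" "C \<in> I" "A \<noteq> B" "A \<noteq> C"
    "s B = L - s A" "s C = L - s A" "s A \<ge> L - s A" "s A < L"
    "x A = 0 \<and> x B = s A \<or> x B = 0 \<and> x A = s B"
    "y A = 0 \<and> y C = s A \<or> y C = 0 \<and> y A = s C"
    "y A < y B + s B" "y B < y A + s A" "x A < x C + s C" "x C < x A + s A"
    by (rule perfect_packing_corner[OF P short card])
  define w where "w = L - s A"
  define I' where "I' = I - (if s A = w then {A, B, C} else {B, C})"
  define s' where "s' = s(A := s A - w)"
  \<comment> \<open>Reflecting when \<open>x A = 0\<close> puts \<open>A\<close> against the right
    side and \<open>B\<close> against the left one; \<open>Y\<close> does the same vertically for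
    \<open>A\<close> and \<open>C\<close>.\<close>
  define X where "X i = (if x A = 0 then L - x i - s i else x i)" for i
  define Y where "Y i = (if y A = 0 then L - y i - s i else y i)" for i
  have w: "0 < w" "s B = w" "s C = w" "s A = L - w" "w \<le> s A" "w < L"
    using ABC P'(3)[OF ABC(1)] unfolding w_def by auto
  have "perfect_packing I X y s L"
    using P perfect_packing_reflect[OF P] unfolding X_def[abs_def] by (cases "x A = 0") simp_all
  then have "perfect_packing I y X s L" by (rule perfect_packing_transpose)
  then have "perfect_packing I Y X s L"
    using perfect_packing_reflect[of I y X s L] unfolding Y_def[abs_def] by (cases "y A = 0") simp_all
  then have XY: "perfect_packing I X Y s L" by (rule perfect_packing_transpose)
  have "X A = w" "Y A = w" "X B = 0" "Y C = 0" "w < Y B + w" "w < X C + w"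
    using ABC w unfolding X_def Y_def by auto
  note contr = perfect_packing_contract_upper_right[OF XY ABC(1-5) w(2-5) this]
  obtain x' y' where pack: "perfect_packing I' x' y' s' (L - w)"
    using contr(1) unfolding I'_def s'_def by blast
  have BC: "B \<noteq> C" by (rule contr(2))
  have fin: "finite I" by (rule P'(1))
  have "sum s' I' = sum s' (I - {B,C})"
    using P'(1) by (intro sum.mono_neutral_left) (auto simp: I'_def s'_def)
  also have "\<dots> = sum s' (I-{B,C}-{A}) + (s A - w)"
    using ABC P'(1) by (subst sum.remove[of _ A]) (auto simp: s'_def)
  also have "sum s' (I-{B,C}-{A}) = sum s (I-{B,C}-{A})"
    by (intro sum.cong) (auto simp: s'_def)
  also have "I-{B,C}-{A} = I - {A,B,C}" by auto
  also have "sum s (I-{A,B,C}) = sum s I - (s A + w + w)"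
    using P'(1) ABC BC w by (subst sum_diff) auto
  finally have sum: "3 * (L - w) - sum s' I' = 3 * L - sum s I" by simp
  have max: "\<forall>i\<in>I. s i \<le> s A"
    using perfect_packing_pair[OF P ABC(1)] w by force
  have "card {B,C} \<le> card I" "card {A,B,C} \<le> card I"
    using fin ABC by (intro card_mono; simp)+
  then have "card I = card I' + (if s A = w then 3 else 2)"
    unfolding I'_def using fin ABC BC by (auto simp: card_Diff_subset)
  then show ?thesis
    using that[OF pack w(1,6) ABC(1) w(4) max sum] w ABC
    by (cases "s A = w") (auto simp: I'_def s'_def)
qed

section \<open>Deficit bounds by induction\<close>

text \<open>The bound by \<open>L - s i\<close> for odd cardinality strengthens the induction:
  applied to the shrunken \<open>A\<close>, it improves \<open>D \<le> 2 * w\<close> to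
  \<open>D \<le> w\<close>. The facts on small cardinalities keep the factors \<open>m\<close> and,
  for odd \<open>m\<close>, \<open>m - 3\<close> positive.\<close>

lemma perfect_packing_deficit_card:
  fixes x y s :: "'a \<Rightarrow> real" and L :: real
  assumes "perfect_packing I x y s L" "sum s I < 3 * L"
  shows "card I \<noteq> 0 \<and> card I \<noteq> 2 \<and> real (card I) * (3 * L - sum s I) \<le> 4 * L \<and>
    (card I = 1 \<longrightarrow> sum s I = L) \<and>
    (odd (card I) \<and> card I \<noteq> 1 \<longrightarrow>
       card I \<ge> 7 \<and> (real (card I) - 3) * (3 * L - sum s I) \<le> 2 * L \<and> (\<forall>i\<in>I. 3 * L - sum s I \<le> L - s i))"
  using assms
proof (induction "card I" arbitrary: I x y s L rule: less_induct)
  case less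
  note P = less.prems(1) and short = less.prems(2)
  note P' = perfect_packingD[OF P]
  define n where "n = card I"
  define D where "D = 3 * L - sum s I"
  have D: "D > 0" unfolding D_def using short by simp
  have L: "L > 0" using P'(2) .
  have n0: "n \<noteq> 0" unfolding n_def using P'(1,2,9) by auto
  show ?case
  proof (cases "n = 1")
    case True
    then obtain i where i: "I = {i}" unfolding n_def by (auto simp: card_1_singleton_iff)
    then have "(s i)\<^sup>2 = L\<^sup>2" "s i > 0" using P' by auto
    then have "s i = L" using L by (simp add: power2_eq_iff)
    then show ?thesis using i L by simp
  next
    case False
    with n0 have n2: "n \<ge> 2" by simp
    then have c2: "card I \<ge> 2" unfolding n_def .
    obtain I' x' y' s' A w where contr: "perfect_packing I' x' y' s' (L - w)" "0 < w" "w < L"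
      "A \<in> I" "s A = L - w" "\<forall>i\<in>I. s i \<le> s A"
      "3 * (L - w) - sum s' I' = 3 * L - sum s I"
      "card I = card I' + 2 \<and> A \<in> I' \<and> s' A = s A - w \<and> 2 * w < L \<or> card I = card I' + 3 \<and> 2 * w = L"
      by (rule perfect_packing_contract[OF P short c2])
    define m where "m = card I'"
    have D': "3 * (L - w) - sum s' I' = D" using contr(7) D_def by simp
    have "card I' < card I" "sum s' I' < 3 * (L - w)" using contr(8) D D' by auto
    from less.hyps[OF this(1) contr(1) this(2), unfolded D', folded m_def]
    have IH: "m \<noteq> 0" "m \<noteq> 2" "m * D \<le> 4 * (L - w)" "m = 1 \<Longrightarrow> sum s' I' = L - w"
      "odd m \<Longrightarrow> m \<noteq> 1 \<Longrightarrow> m \<ge> 7"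
      "odd m \<Longrightarrow> m \<noteq> 1 \<Longrightarrow> (real m - 3) * D \<le> 2 * (L - w)"
      "odd m \<Longrightarrow> m \<noteq> 1 \<Longrightarrow> i \<in> I' \<Longrightarrow> D \<le> L - w - s' i" for i
      by auto
    have area: "D \<le> 2 * w"
      using perfect_packing_deficit_le[OF P contr(4)] contr(3,5) contr(2) unfolding D_def by simp
    \<comment> \<open>\<open>A\<close> is the largest tile, so its bound implies that of every
      tile.\<close>
    have Dw: "\<forall>i\<in>I. D \<le> L - s i" if "D \<le> w"
      using that contr(5,6) by force
    have m1: "D = 2 * (L - w)" if "m = 1" using IH(4)[OF that] D' by simp
    have main: "n \<noteq> 2 \<and> n * D \<le> 4 * L \<and>
       (odd n \<longrightarrow> n \<ge> 7 \<and> (real n - 3) * D \<le> 2 * L \<and> D \<le> w)"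
      using contr(8)
    proof (elim disjE conjE)
      assume c: "card I = card I' + 2" "A \<in> I'" "s' A = s A - w" "2 * w < L"
      have n: "n = m + 2" using c(1) unfolding n_def m_def by simp
      have rn: "real n = real m + 2" using n by simp
      \<comment> \<open>Two bounds balance at \<open>n * w = 2 * L\<close>: below it
        \<open>D \<le> 2 * w\<close> suffices, above it the induction hypothesis does, because then
        \<open>n * (L - w) \<le> m * L\<close>.\<close>
      have n2L: "n * D \<le> 4 * L"
      proof (cases "n * w \<le> 2 * L")
        case True
        have "n * D \<le> n * (2 * w)" using area by (intro mult_left_mono) auto
        then show ?thesis using True by simp
      next
        case False
        have mp: "real m > 0" using IH(1) by simp
        have "m * (n * D) = n * (m * D)" by simp
        also have "\<dots> \<le> n * (4 * (L - w))" using IH(3) by (intro mult_left_mono) auto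
        also have "\<dots> \<le> m * (4 * L)" using False rn by (simp add: algebra_simps)
        finally show ?thesis using mp by simp
      qed
      have "n \<ge> 7 \<and> (real n - 3) * D \<le> 2 * L \<and> D \<le> w" if "odd n"
      proof -
        have "odd m" using that n by simp
        \<comment> \<open>For \<open>m = 1\<close> the deficit is \<open>2 * (L - w)\<close>, and
          \<open>D \<le> 2 * w\<close> would contradict \<open>2 * w < L\<close>.\<close>
        moreover have "m \<noteq> 1" using m1 area c(4) by auto
        \<comment> \<open>\<open>A\<close> survives with side \<open>L - 2 * w\<close> in a square
          of side \<open>L - w\<close>; the difference is \<open>w\<close>.\<close>
        ultimately have o: "m \<ge> 7" "(real m - 3) * D \<le> 2 * (L - w)" "D \<le> w"
          using IH(5,6) IH(7)[OF _ _ c(2)] c(3) contr(5) by auto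
        \<comment> \<open>The same balance with \<open>D \<le> w\<close>, now at
          \<open>(n - 3) * w = 2 * L\<close>.\<close>
        have "(real n - 3) * D \<le> 2 * L"
        proof (cases "(real n - 3) * w \<le> 2 * L")
          case True
          have "(real n - 3) * D \<le> (real n - 3) * w" using o n by (intro mult_left_mono) auto
          then show ?thesis using True by simp
        next
          case False
          have mp: "real m - 3 > 0" using o(1) by simp
          have "(real m - 3) * ((real n - 3) * D) = (real n - 3) * ((real m - 3) * D)" by simp
          also have "\<dots> \<le> (real n - 3) * (2 * (L - w))" using o n by (intro mult_left_mono) auto
          also have "\<dots> \<le> (real m - 3) * (2 * L)" using False rn by (simp add: algebra_simps)
          finally show ?thesis using mp by simp
        qed
        then show ?thesis using o n by simp
      qed
      then show ?thesis using n2L n IH(1) by auto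
    next
      assume c: "card I = card I' + 3" "2 * w = L"
      have n: "n = m + 3" using c(1) unfolding n_def m_def by simp
      have rn: "real n = real m + 3" using n by simp
      \<comment> \<open>Since \<open>L - w = L / 2\<close> and \<open>m = n - 3\<close>, the general
        bound for \<open>m\<close> is already the odd bound for \<open>n\<close>.\<close>
      have mD: "m * D \<le> 2 * L" using IH(3) c(2) by (simp add: field_simps)
      have n3: "(real n - 3) * D \<le> 2 * L" using mD rn by simp
      have DL: "D \<le> L" using area c(2) by simp
      show ?thesis
      proof (cases "m = 1")
        case True
        then show ?thesis using n DL by simp
      next
        case False
        with IH(1,2) have m3: "m \<ge> 3" by simp
        have "3 * D \<le> m * D" using m3 D by (intro mult_right_mono) auto
        then have "n * D \<le> 4 * L" using mD rn by (simp add: algebra_simps)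
        \<comment> \<open>Here \<open>m\<close> is even and at least 4, so
          \<open>m * D \<le> 2 * L\<close> gives \<open>D \<le> L / 2 = w\<close>.\<close>
        moreover have "n \<ge> 7 \<and> D \<le> w" if "odd n"
        proof -
          have "even m" using that n by simp
          then have "m \<ge> 4" using m3 by (cases "m = 3") auto
          moreover from this have "4 * D \<le> m * D" using D by (intro mult_right_mono) auto
          ultimately show ?thesis using mD c(2) n by simp
        qed
        ultimately show ?thesis using n3 n m3 by auto
      qed
    qed
    then show ?thesis
      using n0 False Dw unfolding n_def D_def by auto
  qed
qed

section \<open>Tiles are axis-parallel\<close>

definition box_tile :: "real \<Rightarrow> real \<Rightarrow> real \<Rightarrow> (real \<times> real) set" where
  "box_tile a b s = {a..a + s} \<times> {b..b + s}"

text \<open>For a unit vector \<open>u\<close>, the constrained quantities are the coordinates of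
  \<open>q - p\<close> along \<open>u\<close> and its quarter turn. As inequalities they make
  closedness and interior points immediate.\<close>

definition tilted_tile :: "real \<times> real \<Rightarrow> real \<times> real \<Rightarrow> real \<Rightarrow> (real \<times> real) set" where
  "tilted_tile p u s = {q. 0 \<le> (fst q - fst p) * fst u + (snd q - snd p) * snd u \<and>
     (fst q - fst p) * fst u + (snd q - snd p) * snd u \<le> s \<and>
     0 \<le> (snd q - snd p) * fst u - (fst q - fst p) * snd u \<and>
     (snd q - snd p) * fst u - (fst q - fst p) * snd u \<le> s}"

definition spanned_square ::
    "real \<times> real \<Rightarrow> real \<times> real \<Rightarrow> real \<times> real \<Rightarrow> real \<Rightarrow> (real \<times> real) set" where
  "spanned_square p u v s = {p + x *\<^sub>R u + y *\<^sub>R v | x y. 0 \<le> x \<and> x \<le> s \<and> 0 \<le> y \<and> y \<le> s}"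

lemma spanned_squareI:
  "q = p + x *\<^sub>R u + y *\<^sub>R v \<Longrightarrow> 0 \<le> x \<Longrightarrow> x \<le> s \<Longrightarrow> 0 \<le> y \<Longrightarrow> y \<le> s \<Longrightarrow>
   q \<in> spanned_square p u v s"
  unfolding spanned_square_def by blast

lemma spanned_squareE:
  assumes "q \<in> spanned_square p u v s"
  obtains x y where "q = p + x *\<^sub>R u + y *\<^sub>R v" "0 \<le> x" "x \<le> s" "0 \<le> y" "y \<le> s"
  using assms unfolding spanned_square_def by blast

lemma spanned_square_commute: "spanned_square p u v s = spanned_square p v u s"
proof -
  have "spanned_square p u v s \<subseteq> spanned_square p v u s" for u v
  proof
    fix q assume "q \<in> spanned_square p u v s"
    then obtain x y where xy: "q = p + x *\<^sub>R u + y *\<^sub>R v" "0 \<le> x" "x \<le> s" "0 \<le> y" "y \<le> s"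
      by (rule spanned_squareE)
    then show "q \<in> spanned_square p v u s"
      by (intro spanned_squareI[of q p y v x u]) simp_all
  qed
  then show ?thesis by blast
qed

lemma spanned_square_flip: "spanned_square p u v s = spanned_square (p + s *\<^sub>R u) (- u) v s"
proof -
  have *: "spanned_square p u v s \<subseteq> spanned_square (p + s *\<^sub>R u) (- u) v s" for p u
  proof
    fix q assume "q \<in> spanned_square p u v s"
    then obtain x y where xy: "q = p + x *\<^sub>R u + y *\<^sub>R v" "0 \<le> x" "x \<le> s" "0 \<le> y" "y \<le> s"
      by (rule spanned_squareE)
    then show "q \<in> spanned_square (p + s *\<^sub>R u) (- u) v s"
      by (intro spanned_squareI[of q _ "s - x" _ y]) (simp_all add: scaleR_diff_left)
  qed
  show ?thesis using *[of p u] *[of "p + s *\<^sub>R u" "- u"] by auto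
qed

text \<open>Re-basing a square at the other end of a side reverses that direction, so both can be
  made to point upwards.\<close>

lemma spanned_square_upward:
  obtains p' u' v' where "spanned_square p u v s = spanned_square p' u' v' s"
    "u' \<in> {u, -u}" "v' \<in> {v, -v}" "snd u' \<ge> 0" "snd v' \<ge> 0"
proof -
  have up: "\<exists>p' u'. spanned_square p u v s = spanned_square p' u' v s \<and> u' \<in> {u, -u} \<and> snd u' \<ge> 0"
    for p u v
  proof (cases "snd u \<ge> 0")
    case False
    then have "snd (- u) \<ge> 0" by simp
    then show ?thesis using spanned_square_flip[of p u v s] by blast
  qed blast
  obtain p1 u1 where 1: "spanned_square p u v s = spanned_square p1 u1 v s"
      "u1 \<in> {u, -u}" "snd u1 \<ge> 0" using up[of p u v] by blast
  obtain p2 v1 where 2: "spanned_square p1 v u1 s = spanned_square p2 v1 u1 s"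
      "v1 \<in> {v, -v}" "snd v1 \<ge> 0" using up[of p1 v u1] by blast
  have "spanned_square p u v s = spanned_square p2 u1 v1 s"
    using 1(1) 2(1) spanned_square_commute[of p1 v u1 s] spanned_square_commute[of p2 v1 u1 s] by simp
  then show ?thesis using that 1 2 by blast
qed

lemma spanned_square_axis: "spanned_square p (1, 0) (0, 1) s = box_tile (fst p) (snd p) s"
proof (intro equalityI subsetI)
  fix q assume "q \<in> spanned_square p (1, 0) (0, 1) s"
  then show "q \<in> box_tile (fst p) (snd p) s" unfolding spanned_square_def box_tile_def
    by (auto simp: mem_Times_iff)
next
  fix q assume "q \<in> box_tile (fst p) (snd p) s"
  then have "q = p + (fst q - fst p) *\<^sub>R (1, 0) + (snd q - snd p) *\<^sub>R (0, 1)"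
    "0 \<le> fst q - fst p" "fst q - fst p \<le> s" "0 \<le> snd q - snd p" "snd q - snd p \<le> s"
    unfolding box_tile_def by (auto simp: prod_eq_iff mem_Times_iff)
  then show "q \<in> spanned_square p (1, 0) (0, 1) s" unfolding spanned_square_def by blast
qed

lemma spanned_square_tilted:
  assumes "a\<^sup>2 + b\<^sup>2 = 1"
  shows "spanned_square p (a, b) (- b, a) s = tilted_tile p (a, b) s"
proof (intro equalityI subsetI)
  fix q assume "q \<in> spanned_square p (a, b) (- b, a) s"
  then obtain x y where q: "q = p + x *\<^sub>R (a, b) + y *\<^sub>R (- b, a)" "0 \<le> x" "x \<le> s" "0 \<le> y" "y \<le> s"
    unfolding spanned_square_def by blast
  have "(fst q - fst p) * a + (snd q - snd p) * b = x * (a\<^sup>2 + b\<^sup>2)"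
    "(snd q - snd p) * a - (fst q - fst p) * b = y * (a\<^sup>2 + b\<^sup>2)"
    unfolding q by (simp_all add: algebra_simps power2_eq_square)
  then show "q \<in> tilted_tile p (a, b) s" unfolding tilted_tile_def using q assms by simp
next
  fix q assume q: "q \<in> tilted_tile p (a, b) s"
  define x y where "x = (fst q - fst p) * a + (snd q - snd p) * b"
    and "y = (snd q - snd p) * a - (fst q - fst p) * b"
  have "fst p + x * a - y * b = fst p + (fst q - fst p) * (a\<^sup>2 + b\<^sup>2)"
    "snd p + x * b + y * a = snd p + (snd q - snd p) * (a\<^sup>2 + b\<^sup>2)"
    unfolding x_def y_def by (simp_all add: algebra_simps power2_eq_square)
  then have "q = p + x *\<^sub>R (a, b) + y *\<^sub>R (- b, a)" using assms by (simp add: prod_eq_iff)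
  moreover have "0 \<le> x" "x \<le> s" "0 \<le> y" "y \<le> s"
    using q unfolding tilted_tile_def x_def y_def by auto
  ultimately show "q \<in> spanned_square p (a, b) (- b, a) s" unfolding spanned_square_def by blast
qed

lemma is_square_cases:
  assumes "is_square S s"
  obtains (box) a b where "S = box_tile a b s"
    | (tilted) p u where "S = tilted_tile p u s" "fst u > 0" "snd u > 0" "(fst u)\<^sup>2 + (snd u)\<^sup>2 = 1"
proof -
  obtain p0 u0 v0 where 0: "norm u0 = 1" "norm v0 = 1" "u0 \<bullet> v0 = 0" "S = spanned_square p0 u0 v0 s"
    using assms unfolding is_square_def spanned_square_def by blast
  obtain p u v where 1: "S = spanned_square p u v s" "u \<in> {u0, -u0}" "v \<in> {v0, -v0}"
    "snd u \<ge> 0" "snd v \<ge> 0"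
    using spanned_square_upward[of p0 u0 v0 s] 0(4) by metis
  note Su = 1(1)
  have "norm u = 1" "norm v = 1" "u \<bullet> v = 0" using 0 1 by auto
  moreover obtain a b c d where uv: "u = (a, b)" "v = (c, d)" by (cases u, cases v)
  ultimately have n: "a\<^sup>2 + b\<^sup>2 = 1" "c\<^sup>2 + d\<^sup>2 = 1" "a * c + b * d = 0" and bd: "b \<ge> 0" "d \<ge> 0"
    using 1 by (auto simp: norm_Pair real_sqrt_eq_1_iff)
  \<comment> \<open>A unit vector orthogonal to one pointing right, and not pointing down, is its
    counterclockwise quarter turn.\<close>
  have turn: "z = - y \<and> w = x" if "x > 0" "w \<ge> 0" "x\<^sup>2 + y\<^sup>2 = 1" "z\<^sup>2 + w\<^sup>2 = 1" "x * z + y * w = 0"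
    for x y z w :: real
  proof -
    have z: "z = - (y * w) / x" using that by (simp add: field_simps)
    have "w\<^sup>2 * (x\<^sup>2 + y\<^sup>2) = x\<^sup>2 * (z\<^sup>2 + w\<^sup>2)"
      unfolding z using that(1) by (simp add: field_simps)
    then have "w = x" using that by (simp add: power2_eq_iff_nonneg)
    then show ?thesis using z that by simp
  qed
  have "a * c \<le> 0" using n(3) mult_nonneg_nonneg[OF bd] by linarith
  \<comment> \<open>Orthogonality and \<open>b, d \<ge> 0\<close> rule out two directions pointing
    left. The remaining degenerate cases have one direction \<open>(0, 1)\<close> and the other
    \<open>(-1, 0)\<close>, which is reversed.\<close>
  then have "a > 0 \<or> c > 0 \<or> a = 0 \<or> c = 0"
    using mult_neg_neg[of a c] by (metis linorder_neqE not_less)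
  then consider "a > 0" | "c > 0" | "a = 0" "c \<le> 0" | "c = 0" "a \<le> 0"
    by (cases "a > 0"; cases "c > 0") auto
  then have "\<exists>p a b. a > 0 \<and> b \<ge> 0 \<and> a\<^sup>2 + b\<^sup>2 = 1 \<and> S = spanned_square p (a, b) (- b, a) s"
  proof cases
    case 1
    then show ?thesis using turn[of a d b c] n bd Su uv by blast
  next
    case 2
    have "a = - d \<and> b = c" using turn[of c b d a] 2 n bd by (simp add: add.commute mult.commute)
    then have "S = spanned_square p (c, d) (- d, c) s" using Su uv spanned_square_commute by simp
    then show ?thesis using 2 n bd by blast
  next
    case 3
    then have "b = 1" using n bd by (simp add: power2_eq_1_iff)
    then have "d = 0" using n 3 by simp
    then have "c = -1" using n 3 by (simp add: power2_eq_1_iff)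
    then have "S = spanned_square (p + s *\<^sub>R (-1, 0)) (1, 0) (- 0, 1) s"
      using Su uv 3 \<open>b = 1\<close> \<open>d = 0\<close> spanned_square_commute[of p u v s]
        spanned_square_flip[of p "(-1, 0)" "(0, 1)" s] by simp
    moreover have "(1::real) > 0" "(0::real) \<ge> 0" "1\<^sup>2 + 0\<^sup>2 = (1::real)" by simp_all
    ultimately show ?thesis by blast
  next
    case 4
    then have "d = 1" using n bd by (simp add: power2_eq_1_iff)
    then have "b = 0" using n 4 by simp
    then have "a = -1" using n 4 by (simp add: power2_eq_1_iff)
    then have "S = spanned_square (p + s *\<^sub>R (-1, 0)) (1, 0) (- 0, 1) s"
      using Su uv 4 \<open>b = 0\<close> \<open>d = 1\<close> spanned_square_flip[of p "(-1, 0)" "(0, 1)" s] by simp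
    moreover have "(1::real) > 0" "(0::real) \<ge> 0" "1\<^sup>2 + 0\<^sup>2 = (1::real)" by simp_all
    ultimately show ?thesis by blast
  qed
  then obtain p a b where f: "a > 0" "b \<ge> 0" "a\<^sup>2 + b\<^sup>2 = 1" "S = spanned_square p (a, b) (- b, a) s"
    by blast
  show thesis
  proof (cases "b = 0")
    case True
    then have "a = 1" using f by (simp add: power2_eq_1_iff)
    then show ?thesis using box f True spanned_square_axis by simp
  next
    case False
    then show ?thesis using tilted[of p "(a, b)"] f spanned_square_tilted[OF f(3)] by simp
  qed
qed

lemma tilted_tile_interior:
  "{q. 0 < (fst q - fst p) * fst u + (snd q - snd p) * snd u \<and>
     (fst q - fst p) * fst u + (snd q - snd p) * snd u < s \<and>
     0 < (snd q - snd p) * fst u - (fst q - fst p) * snd u \<and>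
     (snd q - snd p) * fst u - (fst q - fst p) * snd u < s} \<subseteq> interior (tilted_tile p u s)"
  by (rule interior_maximal) (auto simp: tilted_tile_def intro!: open_Collect_conj open_Collect_less continuous_intros)

lemma box_tile_interior: "interior (box_tile a b s) = {a<..<a + s} \<times> {b<..<b + s}"
  unfolding box_tile_def by (simp add: interior_Times)

lemma closed_is_square: "is_square S s \<Longrightarrow> closed S"
proof (erule is_square_cases)
  show "S = box_tile a b s \<Longrightarrow> closed S" for a b
    unfolding box_tile_def by (simp add: closed_Times)
  show "S = tilted_tile p u s \<Longrightarrow> closed S" for p u
    unfolding tilted_tile_def
    by (auto intro!: closed_Collect_conj closed_Collect_le continuous_intros)
qed

text \<open>Close to \<open>p\<close> the ray avoids the finitely many closed sets that miss
  \<open>p\<close>, so whatever covers it there contains \<open>p\<close> as well.\<close>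

lemma finite_closed_cover_ray:
  fixes p d :: "'b::real_normed_vector"
  assumes "finite I" "\<And>i. i \<in> I \<Longrightarrow> closed (S i)" "c0 > 0"
    and cover: "\<And>c. 0 < c \<Longrightarrow> c < c0 \<Longrightarrow> \<exists>i\<in>I. p + c *\<^sub>R d \<in> S i"
  obtains i c where "i \<in> I" "p \<in> S i" "0 < c" "p + c *\<^sub>R d \<in> S i"
proof -
  have "\<forall>i\<in>{i\<in>I. p \<notin> S i}. \<forall>\<^sub>F c in at_right 0. p + c *\<^sub>R d \<in> - S i"
  proof
    fix i assume i: "i \<in> {i\<in>I. p \<notin> S i}"
    have "((\<lambda>c. p + c *\<^sub>R d) \<longlongrightarrow> p + 0 *\<^sub>R d) (at_right 0)" by (intro tendsto_intros)
    then show "\<forall>\<^sub>F c in at_right 0. p + c *\<^sub>R d \<in> - S i"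
      by (rule topological_tendstoD) (use i assms(2) in auto)
  qed
  then have "\<forall>\<^sub>F c in at_right 0. \<forall>i\<in>{i\<in>I. p \<notin> S i}. p + c *\<^sub>R d \<in> - S i"
    using assms(1) by (intro eventually_ball_finite) auto
  moreover have "\<forall>\<^sub>F c in at_right 0. c \<in> {0<..<c0}"
    using assms(3) by (rule eventually_at_right_real)
  ultimately have "\<forall>\<^sub>F c in at_right (0::real). 0 < c \<and> c < c0 \<and> (\<forall>i\<in>{i\<in>I. p \<notin> S i}. p + c *\<^sub>R d \<in> - S i)"
    by eventually_elim auto
  then obtain c where c: "0 < c" "c < c0" "\<forall>i\<in>{i\<in>I. p \<notin> S i}. p + c *\<^sub>R d \<in> - S i"
    using eventually_happens'[OF trivial_limit_at_right_real] by blast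
  then obtain i where "i \<in> I" "p + c *\<^sub>R d \<in> S i" using cover by blast
  then show ?thesis using that[of i c] c by blast
qed

text \<open>A lowest tilted tile has nothing to fill the angle between its lowest vertex and the
  horizontal: an axis-parallel tile there contains a whole quadrant at the vertex, and a tilted
  tile there must have the same lowest vertex, so that both contain the vertical direction.\<close>

lemma square_tiling_box:
  assumes T: "square_tiling n S s" and i: "i < n"
  shows "\<exists>a b. S i = box_tile a b (s i)"
proof (rule ccontr)
  assume nobox: "\<not> ?thesis"
  have sq: "is_square (S i) (s i)" if "i < n" for i using T that unfolding square_tiling_def by blast
  have cov: "(\<Union>i<n. S i) = unit_square" using T unfolding square_tiling_def by blast
  have disj: "interior (S i) \<inter> interior (S j) = {}" if "i < n" "j < n" "i \<noteq> j" for i j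
    using T that unfolding square_tiling_def by blast
  define K where "K = {i. i < n \<and> \<not> (\<exists>a b. S i = box_tile a b (s i))}"
  have "\<forall>i\<in>K. \<exists>p u. S i = tilted_tile p u (s i) \<and> fst u > 0 \<and> snd u > 0 \<and> (fst u)\<^sup>2 + (snd u)\<^sup>2 = 1"
  proof
    fix i assume "i \<in> K"
    then have "i < n" "\<not> (\<exists>a b. S i = box_tile a b (s i))" unfolding K_def by auto
    then show "\<exists>p u. S i = tilted_tile p u (s i) \<and> fst u > 0 \<and> snd u > 0 \<and> (fst u)\<^sup>2 + (snd u)\<^sup>2 = 1"
      by (cases rule: is_square_cases[OF sq[of i]]) blast+
  qed
  then obtain p where "\<forall>i\<in>K. \<exists>u. S i = tilted_tile (p i) u (s i) \<and> fst u > 0 \<and> snd u > 0 \<and>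
      (fst u)\<^sup>2 + (snd u)\<^sup>2 = 1"
    unfolding bchoice_iff by blast
  then obtain u where "\<forall>i\<in>K. S i = tilted_tile (p i) (u i) (s i) \<and> fst (u i) > 0 \<and> snd (u i) > 0 \<and>
      (fst (u i))\<^sup>2 + (snd (u i))\<^sup>2 = 1"
    unfolding bchoice_iff by blast
  then have pu: "\<And>i. i \<in> K \<Longrightarrow> S i = tilted_tile (p i) (u i) (s i)"
    "\<And>i. i \<in> K \<Longrightarrow> fst (u i) > 0" "\<And>i. i \<in> K \<Longrightarrow> snd (u i) > 0"
    "\<And>i. i \<in> K \<Longrightarrow> (fst (u i))\<^sup>2 + (snd (u i))\<^sup>2 = 1" by blast+
  \<comment> \<open>The height above \<open>p j\<close> is a combination of the nonnegative tile
    coordinates with positive coefficients, so \<open>p j\<close> is the unique lowest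
    point.\<close>
  have low: "snd (p j) \<le> snd q \<and> (snd q = snd (p j) \<longrightarrow> q = p j)" if "j \<in> K" "q \<in> S j" for j q
  proof -
    note u = pu(2-4)[OF that(1)]
    define x y where "x = (fst q - fst (p j)) * fst (u j) + (snd q - snd (p j)) * snd (u j)"
      and "y = (snd q - snd (p j)) * fst (u j) - (fst q - fst (p j)) * snd (u j)"
    have xy: "0 \<le> x" "0 \<le> y" using that pu(1)[OF that(1)] unfolding tilted_tile_def x_def y_def by auto
    have "x * snd (u j) + y * fst (u j) = (snd q - snd (p j)) * ((fst (u j))\<^sup>2 + (snd (u j))\<^sup>2)"
      unfolding x_def y_def by (simp add: algebra_simps power2_eq_square)
    then have e: "snd q - snd (p j) = x * snd (u j) + y * fst (u j)" using u by simp
    have "0 \<le> x * snd (u j)" "0 \<le> y * fst (u j)" using xy u by simp_all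
    moreover have "q = p j" if "snd q = snd (p j)"
    proof -
      have "x * snd (u j) = 0" using e that calculation by linarith
      then have "x = 0" using u by simp
      then show ?thesis using that u unfolding x_def by (simp add: prod_eq_iff)
    qed
    ultimately show ?thesis using e by auto
  qed
  have "finite K" "K \<noteq> {}" unfolding K_def using i nobox by auto
  then obtain k where k: "k \<in> K" and kmin: "\<And>j. j \<in> K \<Longrightarrow> snd (p k) \<le> snd (p j)"
    using ex_min_if_finite[of "(\<lambda>j. snd (p j)) ` K"] by (auto simp: not_less)
  have kn: "k < n" using k unfolding K_def by simp
  have sk: "s k > 0" using sq[OF kn] unfolding is_square_def by simp
  obtain a b where ab: "u k = (a, b)" by (cases "u k")
  have ab': "a > 0" "b > 0" "a\<^sup>2 + b\<^sup>2 = 1" using pu(2-4)[OF k] ab by auto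
  note Sk = pu(1)[OF k, unfolded ab]
  have sub: "S k \<subseteq> unit_square" using cov kn by blast
  have "p k \<in> S k" unfolding Sk tilted_tile_def using sk by simp
  moreover have "p k + s k *\<^sub>R (a, b) \<in> S k"
  proof -
    have "s k * a * a + s k * b * b = s k * (a\<^sup>2 + b\<^sup>2)" by (simp add: algebra_simps power2_eq_square)
    then show ?thesis unfolding Sk tilted_tile_def using sk ab' by simp
  qed
  ultimately have "p k \<in> unit_square" "p k + s k *\<^sub>R (a, b) \<in> unit_square"
    using sub by blast+
  then have un: "0 \<le> fst (p k)" "0 \<le> snd (p k)" "fst (p k) + s k * a \<le> 1" "snd (p k) + s k * b \<le> 1"
    unfolding unit_square_def by (auto simp: mem_Times_iff)
  \<comment> \<open>The direction \<open>(2 * a, b)\<close> is flatter than the lower right side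
    \<open>(a, b)\<close> of tile \<open>k\<close>, so the ray leaves this tile at once; the far end
    of that side keeps it inside the unit square.\<close>
  obtain j c where j: "j \<in> {..<n}" "p k \<in> S j" "0 < c" "p k + c *\<^sub>R (2 * a, b) \<in> S j"
  proof (rule finite_closed_cover_ray[of "{..<n}" S "s k / 2" "p k" "(2 * a, b)"])
    fix c assume c: "0 < c" "c < s k / 2"
    have "c * (2 * a) \<le> s k * a" "c * b \<le> s k * b" using c ab' by simp_all
    then have "fst (p k) + c * (2 * a) \<le> 1" "snd (p k) + c * b \<le> 1" using un by linarith+
    then have "p k + c *\<^sub>R (2 * a, b) \<in> unit_square"
      using un c ab' unfolding unit_square_def by (auto simp: mem_Times_iff)
    then show "\<exists>i\<in>{..<n}. p k + c *\<^sub>R (2 * a, b) \<in> S i" using cov by blast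
  qed (use sk closed_is_square[OF sq] in auto)
  have jk: "j \<noteq> k"
  proof
    assume "j = k"
    with j(4) have "p k + c *\<^sub>R (2 * a, b) \<in> S k" by simp
    then have "0 \<le> c * b * a - c * (2 * a) * b" unfolding Sk tilted_tile_def by simp
    moreover have "0 < c * a * b" using j ab' by simp
    ultimately show False by (simp add: algebra_simps)
  qed
  have jn: "j < n" using j by simp
  have dj: "interior (S k) \<inter> interior (S j) = {}" using disj[OF kn jn] jk by blast
  show False
  proof (cases "j \<in> K")
    case True
    \<comment> \<open>Tile \<open>j\<close> contains \<open>p k\<close> and, by the choice of
      \<open>k\<close>, has no lower vertex.\<close>
    have "p j = p k" using low[OF True j(2)] kmin[OF True] by auto
    define z where "z = min (s k / 2) (s j / 2)"
    have sj: "s j > 0" using sq[OF jn] unfolding is_square_def by simp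
    have z: "z > 0" "z < s k" "z < s j" unfolding z_def using sk sj by auto
    have in1: "p l + z *\<^sub>R (0, 1) \<in> interior (S l)" if "l \<in> K" "z < s l" for l
    proof -
      note u = pu(2-4)[OF that(1)]
      have "fst (u l) \<le> 1" "snd (u l) \<le> 1"
        using u by (smt (verit) power2_le_imp_le one_power2 zero_le_power2)+
      then have "z * fst (u l) \<le> z * 1" "z * snd (u l) \<le> z * 1"
        using z by (intro mult_left_mono; simp)+
      then have "z * fst (u l) < s l" "z * snd (u l) < s l" using that(2) by linarith+
      then have "p l + z *\<^sub>R (0, 1) \<in> interior (tilted_tile (p l) (u l) (s l))"
        using z u that by (intro subsetD[OF tilted_tile_interior]) auto
      then show ?thesis using pu(1)[OF that(1)] by simp
    qed
    show False using in1[OF k z(2)] in1[OF True z(3)] \<open>p j = p k\<close> dj by auto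
  next
    case False
    then obtain e f where Sj: "S j = box_tile e f (s j)" using jn unfolding K_def by blast
    \<comment> \<open>Adding \<open>t\<close> times the quarter turn to \<open>(a, b)\<close> gives
      a direction into tile \<open>k\<close> whose horizontal part \<open>a / 2\<close> still points
      right.\<close>
    define t where "t = a / (2 * b)"
    have t: "t > 0" "b * t = a / 2" unfolding t_def using ab' by auto
    \<comment> \<open>The first two bounds keep \<open>q\<close> inside tile \<open>k\<close>; the
      last two keep it inside the open rectangle with opposite corners \<open>p k\<close> and
      \<open>p k + c *\<^sub>R (2 * a, b)\<close>, which lies in the box \<open>S j\<close>.\<close>
    define z where "z = min (min (s k / 2) (s k / (2 * t))) (min c (c * b / (2 * (b + t * a))))"
    have bt: "b + t * a > 0" using ab' t by (simp add: add_pos_pos)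
    have z: "z > 0" unfolding z_def using sk t j(3) ab' bt by auto
    have "z \<le> min (s k / 2) (s k / (2 * t))" "z \<le> min c (c * b / (2 * (b + t * a)))"
      unfolding z_def by (rule min.cobounded1 min.cobounded2)+
    then have "z \<le> s k / 2" "z \<le> s k / (2 * t)" "z \<le> c" "z \<le> c * b / (2 * (b + t * a))"
      by simp_all
    then have z': "z < s k" "z * t < s k" "z \<le> c" "z * (b + t * a) < c * b"
    proof -
      assume *: "z \<le> s k / 2" "z \<le> s k / (2 * t)" "z \<le> c" "z \<le> c * b / (2 * (b + t * a))"
      have "z * (2 * t) \<le> s k" using *(2) t by (simp add: pos_le_divide_eq)
      then show "z * t < s k" using sk by linarith
      have "z * (2 * (b + t * a)) \<le> c * b" using *(4) bt by (simp add: pos_le_divide_eq)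
      moreover have "0 < c * b" using j(3) ab' by simp
      ultimately show "z * (b + t * a) < c * b" by linarith
      show "z < s k" "z \<le> c" using *(1,3) sk by linarith+
    qed
    define q where "q = p k + z *\<^sub>R (a - t * b, b + t * a)"
    have "z * (a - t * b) * a + z * (b + t * a) * b = z * (a\<^sup>2 + b\<^sup>2)"
      "z * (b + t * a) * a - z * (a - t * b) * b = z * t * (a\<^sup>2 + b\<^sup>2)"
      by (simp_all add: algebra_simps power2_eq_square)
    then have e: "z * (a - t * b) * a + z * (b + t * a) * b = z"
      "z * (b + t * a) * a - z * (a - t * b) * b = z * t" using ab'(3) by simp_all
    have q: "fst q - fst (p k) = z * (a - t * b)" "snd q - snd (p k) = z * (b + t * a)"
      unfolding q_def by simp_all
    have "0 < z * t" using z t by simp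
    then have "q \<in> interior (tilted_tile (p k) (a, b) (s k))"
      using z z' by (intro subsetD[OF tilted_tile_interior]) (simp only: mem_Collect_eq fst_conv snd_conv q e simp_thms)
    then have 1: "q \<in> interior (S k)" using Sk by simp
    have ta: "t * b = a / 2" using t by (simp add: mult.commute)
    have "z * (a / 2) < c * (2 * a)"
    proof -
      have "z * a \<le> c * a" using z' ab' by simp
      moreover have "c * a > 0" using j ab' by simp
      ultimately show ?thesis by simp
    qed
    moreover have "0 < z * (a / 2)" "0 < z * (b + t * a)" using z ab' bt by simp_all
    ultimately have "q \<in> interior (S j)"
      using j(2,4) z'(4) unfolding Sj box_tile_interior q_def ta
      by (auto simp: box_tile_def mem_Times_iff)
    then show False using 1 dj by blast
  qed
qed

section \<open>Tilings of the unit square\<close>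

text \<open>By rays in direction \<open>(1, 1)\<close>, the half-open tiles partition the half-open unit square, so the
  area equation follows by integrating in one variable at a time.\<close>

lemma square_tiling_perfect_packing:
  assumes T: "square_tiling n S s"
  shows "\<exists>x y. perfect_packing {..<n} x y s 1"
proof -
  have "\<forall>i\<in>{..<n}. \<exists>a b. S i = box_tile a b (s i)" using square_tiling_box[OF T] by blast
  then obtain x where "\<forall>i\<in>{..<n}. \<exists>b. S i = box_tile (x i) b (s i)"
    unfolding bchoice_iff by blast
  then obtain y where "\<forall>i\<in>{..<n}. S i = box_tile (x i) (y i) (s i)"
    unfolding bchoice_iff by blast
  then have S: "S i = box_tile (x i) (y i) (s i)" if "i < n" for i using that by blast
  have s: "s i > 0" if "i < n" for i
    using T that unfolding square_tiling_def is_square_def by blast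
  have cov: "(\<Union>i<n. S i) = unit_square" using T unfolding square_tiling_def by blast
  have inside: "0 \<le> x i \<and> x i + s i \<le> 1 \<and> 0 \<le> y i \<and> y i + s i \<le> 1" if i: "i < n" for i
  proof -
    have "S i \<subseteq> unit_square" using cov i by blast
    moreover have "(x i, y i) \<in> S i" "(x i + s i, y i + s i) \<in> S i"
      using S[OF i] s[OF i] by (auto simp: box_tile_def)
    ultimately have "(x i, y i) \<in> unit_square" "(x i + s i, y i + s i) \<in> unit_square" by blast+
    then show ?thesis by (auto simp: unit_square_def)
  qed
  have sep: "x i + s i \<le> x j \<or> x j + s j \<le> x i \<or> y i + s i \<le> y j \<or> y j + s j \<le> y i"
    if ij: "i < n" "j < n" "i \<noteq> j" for i j
  proof (rule ccontr)
    assume ov: "\<not> ?thesis"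
    have mid: "\<exists>c. c \<in> {a<..<b} \<and> c \<in> {a'<..<b'}"
      if "a < b" "a' < b'" "a < b'" "a' < b" for a b a' b' :: real
      using dense[of "max a a'" "min b b'"] that by auto
    obtain c where "c \<in> {x i<..<x i + s i}" "c \<in> {x j<..<x j + s j}"
      using mid[of "x i" "x i + s i" "x j" "x j + s j"] ov s ij by auto
    moreover obtain e where "e \<in> {y i<..<y i + s i}" "e \<in> {y j<..<y j + s j}"
      using mid[of "y i" "y i + s i" "y j" "y j + s j"] ov s ij by auto
    ultimately have "(c, e) \<in> interior (S i) \<inter> interior (S j)"
      using S ij by (simp add: box_tile_interior)
    moreover have "interior (S i) \<inter> interior (S j) = {}"
      using T ij unfolding square_tiling_def by blast
    ultimately show False by blast
  qed
  have part: "(\<Sum>i<n. indicat_real {y i..<y i + s i} b * indicat_real {x i..<x i + s i} a) = 1"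
    if ab: "0 \<le> a" "a < 1" "0 \<le> b" "b < 1" for a b
  proof -
    have sq: "is_square (S i) (s i)" if "i < n" for i using T that unfolding square_tiling_def by blast
    \<comment> \<open>A tile containing both \<open>(a, b)\<close> and a point further along
      \<open>(1, 1)\<close> has \<open>(a, b)\<close> in its half-open version.\<close>
    obtain i c where i: "i \<in> {..<n}" "(a, b) \<in> S i" "0 < c" "(a, b) + c *\<^sub>R (1, 1) \<in> S i"
    proof (rule finite_closed_cover_ray[of "{..<n}" S "min (1 - a) (1 - b)" "(a, b)" "(1, 1)"])
      fix c assume "0 < c" "c < min (1 - a) (1 - b)"
      then have "(a, b) + c *\<^sub>R (1, 1) \<in> unit_square" using ab unfolding unit_square_def by auto
      then show "\<exists>i\<in>{..<n}. (a, b) + c *\<^sub>R (1, 1) \<in> S i" using cov by blast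
    qed (use ab closed_is_square[OF sq] in auto)
    then have m: "i < n" "a \<in> {x i..<x i + s i}" "b \<in> {y i..<y i + s i}"
      using S[of i] by (auto simp: box_tile_def)
    have "(\<Sum>j<n. indicat_real {y j..<y j + s j} b * indicat_real {x j..<x j + s j} a)
        = (\<Sum>j<n. if j = i then 1 else 0)"
    proof (rule sum.cong)
      fix j assume "j \<in> {..<n}"
      then show "indicat_real {y j..<y j + s j} b * indicat_real {x j..<x j + s j} a
          = (if j = i then 1 else 0)"
        using m sep[of i j] by (auto simp: indicator_def)
    qed simp
    then show ?thesis using m by simp
  qed
  \<comment> \<open>One integration for both variables: first over \<open>x\<close> with vertical
    indicators as weights, then over \<open>y\<close> with the sides as weights.\<close>
  have full: "(\<Sum>i<n. c i) = 1"
    if "\<And>t. 0 \<le> t \<Longrightarrow> t < 1 \<Longrightarrow> (\<Sum>i<n. w i * indicat_real {z i..<z i + s i} t) = 1"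
      and z: "\<And>i. i < n \<Longrightarrow> 0 \<le> z i \<and> z i + s i \<le> 1" and c: "\<And>i. i < n \<Longrightarrow> c i = w i * s i"
    for w z c :: "nat \<Rightarrow> real"
  proof -
    have "((\<lambda>t. \<Sum>i<n. w i * indicat_real {z i..<z i + s i} t) has_integral
        (\<Sum>i<n. w i * (z i + s i - z i))) {0..1}"
      using z s by (intro has_integral_sum has_integral_mult_right has_integral_indicator_interval)
        (auto intro: less_imp_le)
    \<comment> \<open>The half-open intervals miss the endpoint 1.\<close>
    then have "((\<lambda>t::real. 1::real) has_integral (\<Sum>i<n. w i * (z i + s i - z i))) {0..1}"
      by (rule has_integral_spike_finite[where S = "{1}", rotated 2]) (use that(1) in auto)
    moreover have "((\<lambda>t::real. 1::real) has_integral 1) {0..1}"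
      using has_integral_const_real[of "1::real" 0 1] by simp
    ultimately have "(\<Sum>i<n. w i * (z i + s i - z i)) = 1" by (rule has_integral_unique)
    then show ?thesis using c by simp
  qed
  have row: "(\<Sum>i<n. s i * indicat_real {y i..<y i + s i} b) = 1" if "0 \<le> b" "b < 1" for b
    by (rule full[of "\<lambda>i. indicat_real {y i..<y i + s i} b" x]) (use part that inside in auto)
  have "(\<Sum>i<n. (s i)\<^sup>2) = 1"
    by (rule full[of s y]) (use row inside in \<open>auto simp: power2_eq_square\<close>)
  then show ?thesis
    using s inside sep unfolding perfect_packing_def by (intro exI[of _ x] exI[of _ y]) auto
qed

section \<open>Extremal tilings\<close>

text \<open>Coverage is pointwise here, unlike in \<open>perfect_packing\<close>, because the union
  of the tiles has to be exhibited as the whole square.\<close>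

definition box_tiling ::
    "nat \<Rightarrow> (nat \<Rightarrow> real) \<Rightarrow> (nat \<Rightarrow> real) \<Rightarrow> (nat \<Rightarrow> real) \<Rightarrow> bool" where
  "box_tiling n x y s \<longleftrightarrow>
     (\<forall>i<n. 0 < s i \<and> 0 \<le> x i \<and> x i + s i \<le> 1 \<and> 0 \<le> y i \<and> y i + s i \<le> 1) \<and>
     (\<forall>i<n. \<forall>j<n. i \<noteq> j \<longrightarrow>
        x i + s i \<le> x j \<or> x j + s j \<le> x i \<or> y i + s i \<le> y j \<or> y j + s j \<le> y i) \<and>
     (\<forall>a\<in>{0..1}. \<forall>b\<in>{0..1}. \<exists>i<n. a \<in> {x i..x i + s i} \<and> b \<in> {y i..y i + s i})"

lemma box_tiling_total_lengths:
  assumes "box_tiling n x y s"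
  shows "(\<Sum>i<n. s i) \<in> total_lengths n"
proof -
  have "is_square (box_tile (x i) (y i) (s i)) (s i)" if "i < n" for i
  proof -
    have "box_tile (x i) (y i) (s i) = spanned_square (x i, y i) (1, 0) (0, 1) (s i)"
      by (simp add: spanned_square_axis)
    moreover have "s i > 0" using assms that unfolding box_tiling_def by blast
    moreover have "norm (1::real, 0::real) = 1" "norm (0::real, 1::real) = 1"
      "(1::real, 0::real) \<bullet> (0::real, 1::real) = 0" by (simp_all add: norm_Pair)
    ultimately show ?thesis unfolding is_square_def spanned_square_def by blast
  qed
  moreover have "(\<Union>i<n. box_tile (x i) (y i) (s i)) = unit_square"
  proof (intro equalityI subsetI)
    fix q assume "q \<in> (\<Union>i<n. box_tile (x i) (y i) (s i))"
    then obtain i where i: "i < n" "q \<in> box_tile (x i) (y i) (s i)" by blast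
    moreover have "0 \<le> x i \<and> x i + s i \<le> 1 \<and> 0 \<le> y i \<and> y i + s i \<le> 1"
      using assms i(1) unfolding box_tiling_def by blast
    ultimately show "q \<in> unit_square" unfolding box_tile_def unit_square_def by auto
  next
    fix q assume "q \<in> unit_square"
    then have "fst q \<in> {0..1}" "snd q \<in> {0..1}" unfolding unit_square_def by auto
    then obtain i where "i < n" "fst q \<in> {x i..x i + s i}" "snd q \<in> {y i..y i + s i}"
      using assms unfolding box_tiling_def by blast
    then show "q \<in> (\<Union>i<n. box_tile (x i) (y i) (s i))"
      unfolding box_tile_def by (auto simp: mem_Times_iff)
  qed
  moreover have "interior (box_tile (x i) (y i) (s i)) \<inter> interior (box_tile (x j) (y j) (s j)) = {}"
    if "i < n" "j < n" "i \<noteq> j" for i j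
  proof -
    have "x i + s i \<le> x j \<or> x j + s j \<le> x i \<or> y i + s i \<le> y j \<or> y j + s j \<le> y i"
      using assms that unfolding box_tiling_def by blast
    then show ?thesis by (auto simp: box_tile_interior)
  qed
  ultimately have "square_tiling n (\<lambda>i. box_tile (x i) (y i) (s i)) s"
    unfolding square_tiling_def by blast
  then show ?thesis unfolding total_lengths_def by blast
qed

text \<open>Quartering tile \<open>j\<close> replaces one side by four halves, which adds three
  tiles and the length \<open>s j\<close>.\<close>

lemma box_tiling_split:
  assumes T: "box_tiling n x y s" and j: "j < n"
  obtains x' y' s' where "box_tiling (n + 3) x' y' s'" "(\<Sum>i<n+3. s' i) = (\<Sum>i<n. s i) + s j"
proof -
  \<comment> \<open>Index \<open>j\<close> keeps the lower left quarter; \<open>n\<close>,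
    \<open>n + 1\<close> and \<open>n + 2\<close> are the lower right, upper left and upper right
    ones.\<close>
  define x' where "x' i = (if i < n then x i else if i = n + 1 then x j else x j + s j / 2)" for i
  define y' where "y' i = (if i < n then y i else if i = n then y j else y j + s j / 2)" for i
  define s' where "s' i = (if i < n \<and> i \<noteq> j then s i else s j / 2)" for i
  \<comment> \<open>\<open>par i\<close> is the old tile containing piece \<open>i\<close>; pieces
    of different old tiles inherit their separation.\<close>
  define par where "par i = (if i < n then i else j)" for i
  have s: "s i > 0" if "i < n" for i using T that unfolding box_tiling_def by blast
  have par: "par i < n" "0 < s' i" "x (par i) \<le> x' i" "x' i + s' i \<le> x (par i) + s (par i)"
     "y (par i) \<le> y' i" "y' i + s' i \<le> y (par i) + s (par i)" for i
    using j s[OF j] s[of i] unfolding par_def x'_def y'_def s'_def by auto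
  have "0 < s' i \<and> 0 \<le> x' i \<and> x' i + s' i \<le> 1 \<and> 0 \<le> y' i \<and> y' i + s' i \<le> 1" for i
  proof -
    have "0 \<le> x (par i) \<and> x (par i) + s (par i) \<le> 1 \<and> 0 \<le> y (par i) \<and> y (par i) + s (par i) \<le> 1"
      using T par(1)[of i] unfolding box_tiling_def by blast
    then show ?thesis using par(2-6)[of i] by linarith
  qed
  moreover have "x' i + s' i \<le> x' l \<or> x' l + s' l \<le> x' i \<or> y' i + s' i \<le> y' l \<or> y' l + s' l \<le> y' i"
    if il: "i < n + 3" "l < n + 3" "i \<noteq> l" for i l
  proof (cases "par i = par l")
    case False
    then have "x (par i) + s (par i) \<le> x (par l) \<or> x (par l) + s (par l) \<le> x (par i) \<or>
        y (par i) + s (par i) \<le> y (par l) \<or> y (par l) + s (par l) \<le> y (par i)"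
      using T par(1) unfolding box_tiling_def by blast
    then show ?thesis using par(3-6)[of i] par(3-6)[of l] by linarith
  next
    case True
    have in4: "k \<in> {j, n, n + 1, n + 2}" if "k < n + 3" "par k = j" for k
      using that unfolding par_def by (auto split: if_splits)
    have "par i = j" using True il unfolding par_def by (auto split: if_splits)
    then have "i \<in> {j, n, n + 1, n + 2}" "l \<in> {j, n, n + 1, n + 2}"
      using in4 il True by auto
    then show ?thesis using il(3) j unfolding x'_def y'_def s'_def by auto
  qed
  moreover have "\<exists>i<n+3. a \<in> {x' i..x' i + s' i} \<and> b \<in> {y' i..y' i + s' i}"
    if ab: "a \<in> {0..1}" "b \<in> {0..1}" for a b
  proof -
    obtain i where i: "i < n" "a \<in> {x i..x i + s i}" "b \<in> {y i..y i + s i}"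
      using T ab unfolding box_tiling_def by blast
    show ?thesis
    proof (cases "i = j")
      case False
      then show ?thesis using i by (intro exI[of _ i]) (auto simp: x'_def y'_def s'_def)
    next
      case True
      define l where "l = (if a \<le> x j + s j / 2 then if b \<le> y j + s j / 2 then j else n + 1
        else if b \<le> y j + s j / 2 then n else n + 2)"
      show ?thesis using i j True
        by (intro exI[of _ l]) (auto simp: x'_def y'_def s'_def l_def field_simps)
    qed
  qed
  ultimately have "box_tiling (n + 3) x' y' s'" unfolding box_tiling_def by blast
  moreover have "(\<Sum>i<n+3. s' i) = (\<Sum>i<n. s i) + s j"
  proof -
    have "(\<Sum>i<n+3. s' i) = (\<Sum>i<n. s' i) + 3 * (s j / 2)"
      by (simp add: eval_nat_numeral s'_def)
    also have "(\<Sum>i<n. s' i) = s j / 2 + (\<Sum>i\<in>{..<n}-{j}. s i)"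
      using j by (subst sum.remove[of _ j]) (auto simp: s'_def)
    also have "(\<Sum>i\<in>{..<n}-{j}. s i) = (\<Sum>i<n. s i) - s j"
      using j by (simp add: sum_diff1)
    finally show ?thesis by simp
  qed
  ultimately show ?thesis by (rule that)
qed

lemma box_tiling_corner:
  fixes k :: nat
  assumes k: "k \<ge> 2"
  obtains x y s where "box_tiling (2 * k) x y s" "(\<Sum>i<2*k. s i) = 3 - 2 / real k" "s 1 = 1 / real k"
proof -
  define d where "d = 1 / real k"
  have d: "d > 0" "real k * d = 1" "2 * d \<le> 1" using k unfolding d_def by (auto simp: field_simps)
  \<comment> \<open>Tile 0 is the large one at the lower left, tiles \<open>1\<close> to
    \<open>k\<close> form the right column including the top corner, and the remaining
    \<open>k - 1\<close> tiles form the top row.\<close>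
  define x where "x i = (if i = 0 then 0 else if i \<le> k then 1 - d else (real i - real k - 1) * d)" for i
  define y where "y i = (if i = 0 then 0 else if i \<le> k then (real i - 1) * d else 1 - d)" for i
  define s where "s i = (if i = 0 then 1 - d else d)" for i :: nat
  have step: "real i * d + d \<le> real j * d" if "i < j" for i j
  proof -
    have "(real i + 1) * d \<le> real j * d" using that d by (intro mult_right_mono) auto
    then show ?thesis by (simp add: algebra_simps)
  qed
  have kd: "real (2 * k) * d = 2" using d by simp
  have "0 < s i \<and> 0 \<le> x i \<and> x i + s i \<le> 1 \<and> 0 \<le> y i \<and> y i + s i \<le> 1" if i: "i < 2 * k" for i
  proof -
    consider "i = 0" | "0 < i" "i < k + 1" | "k < i" using i by linarith
    then show ?thesis
    proof cases
      case 2
      have "real i * d + d \<le> real (k + 1) * d" using step 2 by blast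
      moreover have "real (k + 1) * d = 1 + d" using d by (simp add: distrib_right)
      ultimately have "real i * d \<le> 1" by linarith
      then show ?thesis using 2 step[of 0 i] d unfolding x_def y_def s_def
        by (auto simp: algebra_simps)
    next
      case 3
      then show ?thesis using step[of k i] step[OF i] kd d unfolding x_def y_def s_def
        by (auto simp: algebra_simps)
    qed (use d in \<open>auto simp: x_def y_def s_def\<close>)
  qed
  moreover have "x i + s i \<le> x j \<or> x j + s j \<le> x i \<or> y i + s i \<le> y j \<or> y j + s j \<le> y i"
    if ij: "i < 2 * k" "j < 2 * k" "i \<noteq> j" for i j
  proof -
    have "x i + s i \<le> x j \<or> x j + s j \<le> x i \<or> y i + s i \<le> y j \<or> y j + s j \<le> y i"
      if "i < j" "j < 2 * k" for i j
      using that step[OF that(1)] step[OF that(2)] kd d unfolding x_def y_def s_def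
      by (auto simp: algebra_simps)
    then show ?thesis using ij by (meson linorder_neqE_nat)
  qed
  moreover have "\<exists>i<2*k. a \<in> {x i..x i + s i} \<and> b \<in> {y i..y i + s i}"
    if ab: "a \<in> {0..1}" "b \<in> {0..1}" for a b
  proof -
    have grid: "\<exists>m<k. real m * d \<le> t \<and> t \<le> (real m + 1) * d" if "t \<in> {0..1}" for t
    \<comment> \<open>At \<open>t = 1\<close> the floor would give the nonexistent cell
      \<open>k\<close>, so the last cell is used.\<close>
    proof (cases "t = 1")
      case True
      then show ?thesis using k d by (intro exI[of _ "k - 1"]) (auto simp: of_nat_diff algebra_simps)
    next
      case False
      define m where "m = nat \<lfloor>t * real k\<rfloor>"
      have "0 \<le> t * real k" "t * real k < real k" using that False k by auto
      then have "real m \<le> t * real k" "t * real k < real m + 1" "m < k"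
        unfolding m_def by (auto simp: of_nat_nat nat_less_iff floor_less_iff)
      then show ?thesis using k unfolding d_def by (intro exI[of _ m]) (auto simp: field_simps)
    qed
    consider "a \<le> 1 - d" "b \<le> 1 - d" | "1 - d < a" | "a \<le> 1 - d" "1 - d < b" by linarith
    then show ?thesis
    proof cases
      case 1
      then show ?thesis using ab k by (intro exI[of _ 0]) (auto simp: x_def y_def s_def)
    next
      case 2
      obtain m where "m < k" "real m * d \<le> b" "b \<le> (real m + 1) * d" using grid[OF ab(2)] by blast
      then show ?thesis using 2 ab
        by (intro exI[of _ "m + 1"]) (auto simp: x_def y_def s_def algebra_simps)
    next
      case 3
      obtain m where m: "m < k" "real m * d \<le> a" "a \<le> (real m + 1) * d" using grid[OF ab(1)] by blast
      show ?thesis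
      proof (cases "m = k - 1")
        \<comment> \<open>The top row has only \<open>k - 1\<close> tiles; in its missing last cell
          only the boundary value \<open>a = 1 - d\<close> remains, which tile \<open>k\<close>
          covers.\<close>
        case True
        then have "real m * d = 1 - d" using k d by (simp add: of_nat_diff algebra_simps)
        then have "a = 1 - d" using m 3 by simp
        then show ?thesis using 3 ab k d
          by (intro exI[of _ k]) (auto simp: x_def y_def s_def algebra_simps)
      next
        case False
        then show ?thesis using 3 ab m
          by (intro exI[of _ "k + 1 + m"]) (auto simp: x_def y_def s_def algebra_simps)
      qed
    qed
  qed
  ultimately have "box_tiling (2 * k) x y s" unfolding box_tiling_def by blast
  moreover have "(\<Sum>i<2*k. s i) = 3 - 2 / real k"
  proof -
    have "(\<Sum>i<2*k. s i) = (1 - d) + (\<Sum>i\<in>{..<2*k}-{0}. s i)"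
      using k by (subst sum.remove[of _ 0]) (auto simp: s_def)
    also have "(\<Sum>i\<in>{..<2*k}-{0}. s i) = (\<Sum>i\<in>{..<2*k}-{0}. d)"
      by (intro sum.cong) (auto simp: s_def)
    also have "\<dots> = (2 * real k - 1) * d" using k by (simp add: card_Diff_subset of_nat_diff)
    finally show ?thesis using d unfolding d_def[symmetric] by (simp add: algebra_simps d_def)
  qed
  moreover have "s 1 = 1 / real k" unfolding s_def d_def by simp
  ultimately show ?thesis by (rule that)
qed

section \<open>The minimum values\<close>

lemma total_lengths_deficit:
  assumes "\<sigma> \<in> total_lengths n" "\<sigma> < 3"
  shows "real n * (3 - \<sigma>) \<le> 4" "odd n \<Longrightarrow> n \<noteq> 1 \<Longrightarrow> (real n - 3) * (3 - \<sigma>) \<le> 2"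
proof -
  obtain S s where T: "square_tiling n S s" and \<sigma>: "\<sigma> = (\<Sum>i<n. s i)"
    using assms unfolding total_lengths_def by blast
  obtain x y where "perfect_packing {..<n} x y s 1"
    using square_tiling_perfect_packing[OF T] by blast
  from perfect_packing_deficit_card[OF this] assms(2)
  show "real n * (3 - \<sigma>) \<le> 4" "odd n \<Longrightarrow> n \<noteq> 1 \<Longrightarrow> (real n - 3) * (3 - \<sigma>) \<le> 2"
    unfolding \<sigma> by auto
qed

theorem theorem8:
  fixes k :: nat
  assumes "k \<ge> 2"
  shows "f_m (2 * k) \<in> total_lengths (2 * k) \<and> f_m (2 * k) = 3 - 2 / real k \<and>
         f_m (2 * k + 3) \<in> total_lengths (2 * k + 3) \<and> f_m (2 * k + 3) = 3 - 1 / real k"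
proof -
  have k: "real k > 0" using assms by simp
  obtain x y s where T: "box_tiling (2 * k) x y s" "(\<Sum>i<2*k. s i) = 3 - 2 / real k" "s 1 = 1 / real k"
    by (rule box_tiling_corner[OF assms])
  have even_mem: "3 - 2 / real k \<in> total_lengths (2 * k)"
    using box_tiling_total_lengths[OF T(1)] T(2) by simp
  \<comment> \<open>Tile 1 is a small one, so quartering it adds \<open>1 / real k\<close>.\<close>
  have "1 < 2 * k" using assms by simp
  then obtain x' y' s' where "box_tiling (2 * k + 3) x' y' s'"
      "(\<Sum>i<2*k+3. s' i) = (\<Sum>i<2*k. s i) + s 1"
    by (rule box_tiling_split[OF T(1)])
  then have odd_mem: "3 - 1 / real k \<in> total_lengths (2 * k + 3)"
    using box_tiling_total_lengths[of "2 * k + 3" x' y' s'] T(2,3) by simp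
  have even_le: "3 - 2 / real k \<le> \<sigma>" if "\<sigma> \<in> total_lengths (2 * k)" for \<sigma>
  proof (cases "\<sigma> < 3")
    case True
    then have "real (2 * k) * (3 - \<sigma>) \<le> 4" by (rule total_lengths_deficit(1)[OF that])
    then show ?thesis using k by (simp add: field_simps)
  next
    case False
    then have "3 \<le> \<sigma>" "0 \<le> 2 / real k" by simp_all
    then show ?thesis by linarith
  qed
  \<comment> \<open>The factor \<open>n - 3\<close> is \<open>2 * k\<close> here, so the deficit is
    at most \<open>1 / real k\<close>.\<close>
  have odd_le: "3 - 1 / real k \<le> \<sigma>" if "\<sigma> \<in> total_lengths (2 * k + 3)" for \<sigma>
  proof (cases "\<sigma> < 3")
    case True
    then have "(real (2 * k + 3) - 3) * (3 - \<sigma>) \<le> 2" by (rule total_lengths_deficit(2)[OF that]) simp_all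
    then show ?thesis using k by (simp add: field_simps)
  next
    case False
    then have "3 \<le> \<sigma>" "0 \<le> 1 / real k" by simp_all
    then show ?thesis by linarith
  qed
  have "f_m (2 * k) = 3 - 2 / real k" "f_m (2 * k + 3) = 3 - 1 / real k"
    unfolding f_m_def using even_mem even_le odd_mem odd_le by (auto intro: cInf_eq_minimum)
  then show ?thesis using even_mem odd_mem by simp
qed

end
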